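(* For any pair of real $2\times 2$ matrices $\{A,B\}$, the product $AABABABB$ never delivers a single maximum (up to cyclic shifts and mirror images) to the normalized spectral radius among all the products of $A$ and $B$ of length $8$ or less. That is, for all real $2\times 2$ matrices $A,B$ there exists a word $u$ over the alphabet $\{1,2\}$ of length $n$ with $1\le n\le 8$, such that $u$ is neither a cyclic shift of $w=11212122$ nor a cyclic shift of the mirror image of $w$, and $$\rho(P(u))^{1/n}\ \ge\ \rho(AABABABB)^{1/8}.$$
   Context: For a square matrix $M$, $\rho(M)$ denotes its spectral radius (the maximal absolute value of its, possibly complex, eigenvalues). For a given pair $\{A,B\}$ and a nonempty finite word $u=u_1\dots u_n$ over $\{1,2\}$, $P(u)$ denotes the matrix product obtained by substituting $A$ for $1$ and $B$ for $2$, i.e. $P(u)=P(u_1)\cdots P(u_n)$ with $P(1)=A$, $P(2)=B$; the length of the product is $n$. The normalized spectral radius of a product $\Pi=A_1\cdots A_n$ of length $n$ is $\rho(\Pi)^{1/n}$. The mirror image of a word is the word with its digits written in the opposite order. The word $w=11212122$ encodes the product $P(w)=AABABABB$. *)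

theory Defs
  imports "Jordan_Normal_Form.Spectral_Radius"
begin

text \<open>Words over the alphabet \<open>{1, 2}\<close> are lists of naturals with entries in \<open>{1, 2}\<close>;
  \<open>letter_mat\<close> is meaningful on these two digits only.\<close>

definition letter_mat :: "real mat \<Rightarrow> real mat \<Rightarrow> nat \<Rightarrow> real mat" where
  "letter_mat A B d = (if d = 1 then A else B)"

text \<open>For \<open>2 \<times> 2\<close> matrices. The trailing identity of the fold only matters for the empty word.\<close>

definition word_prod :: "real mat \<Rightarrow> real mat \<Rightarrow> nat list \<Rightarrow> real mat" where
  "word_prod A B u = foldr (\<lambda>d M. letter_mat A B d * M) u (1\<^sub>m 2)"

text \<open>Eigenvalues of a real matrix are taken in the complex numbers.\<close>

definition real_spectral_radius :: "real mat \<Rightarrow> real" where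
  "real_spectral_radius M = spectral_radius (map_mat complex_of_real M)"

definition normalized_spectral_radius :: "real mat \<Rightarrow> real mat \<Rightarrow> nat list \<Rightarrow> real" where
  "normalized_spectral_radius A B u = root (length u) (real_spectral_radius (word_prod A B u))"

definition cyclic_shift_of :: "'a list \<Rightarrow> 'a list \<Rightarrow> bool" where
  "cyclic_shift_of u v \<longleftrightarrow> (\<exists>k. u = rotate k v)"

definition w_word :: "nat list" where
  "w_word = [1, 1, 2, 1, 2, 1, 2, 2]"

end

theory Submission
  imports Defs
begin

text \<open>
  All competing words can be taken of length \<open>8\<close> with four letters of each kind, namely
  \<open>(AB)\<^sup>4\<close>, \<open>(AABB)\<^sup>2\<close> and \<open>AABABBAB\<close>. Their products and \<open>AABABABB\<close> have the same determinant
  \<open>d\<^sup>4\<close>, where \<open>d = det A det B\<close>. For a real two by two matrix of given nonnegative determinant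
  \<open>\<delta>\<close> the spectral radius is a nondecreasing function of the absolute value of the trace, and it
  is constant (equal to \<open>\<surd>\<delta>\<close>) as long as that absolute value is at most \<open>2 \<surd>\<delta>\<close>
  (\<open>real_spectral_radius_2x2\<close>, \<open>largest_root_modulus_mono\<close>). So the whole question is whether the
  trace of \<open>AABABABB\<close> is dominated in absolute value by one of the three other traces or by
  \<open>2 d\<^sup>2\<close>.

  By the Cayley-Hamilton theorem all four traces are polynomials in just three real numbers:
  \<open>d\<close>, \<open>t = tr AABB\<close> and \<open>s = (tr AB)\<^sup>2\<close> (\<open>word_traces\<close>):
    \<^item> \<open>tr AABABABB = (s - d) t - s d\<close>,
    \<^item> \<open>tr (AB)\<^sup>4 = (s - 2 d)\<^sup>2 - 2 d\<^sup>2\<close> and \<open>tr (AABB)\<^sup>2 = t\<^sup>2 - 2 d\<^sup>2\<close>,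
    \<^item> \<open>tr AABABBAB = s (t - d) - d (s - 2 d)\<close>.

  Since \<open>A\<close> and \<open>B\<close> are real, \<open>s \<ge> 0\<close>, and the domination is an elementary
  inequality (\<open>trace_inequality\<close>). Its key feature is that on the line \<open>t = s - 2 d\<close>, where
  \<open>(AB)\<^sup>2\<close> and \<open>AABB\<close> have equal traces, the first polynomial agrees with the next two, so
  when it is increasing in \<open>s\<close> and in \<open>t\<close> it cannot exceed both of them. This suffices for
  \<open>d \<le> 0\<close>; for \<open>d > 0\<close> the trace of \<open>AABABABB\<close> can be large and negative, and then
  \<open>AABABBAB\<close> takes over.
\<close>

section \<open>Traces and determinants of two by two matrices\<close>

definition mat_trace :: "'a::comm_monoid_add mat \<Rightarrow> 'a" where
  "mat_trace M = (\<Sum>i<dim_row M. M $$ (i, i))"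

lemma mat_trace_2x2:
  assumes "M \<in> carrier_mat 2 2"
  shows "mat_trace M = M $$ (0, 0) + M $$ (1, 1)"
  using assms by (simp add: mat_trace_def numeral_2_eq_2)

lemma mat_trace_mult_commute:
  fixes M N :: "'a::comm_semiring_0 mat"
  assumes M: "M \<in> carrier_mat m n" and N: "N \<in> carrier_mat n m"
  shows "mat_trace (M * N) = mat_trace (N * M)"
proof -
  have "mat_trace (M * N) = (\<Sum>i<m. \<Sum>j<n. M $$ (i, j) * N $$ (j, i))"
    using M N by (simp add: mat_trace_def scalar_prod_def lessThan_atLeast0)
  also have "\<dots> = (\<Sum>j<n. \<Sum>i<m. N $$ (j, i) * M $$ (i, j))"
    by (subst sum.swap) (simp add: mult.commute)
  also have "\<dots> = mat_trace (N * M)"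
    using M N by (simp add: mat_trace_def scalar_prod_def lessThan_atLeast0)
  finally show ?thesis .
qed

lemma det_2x2:
  fixes M :: "'a::comm_ring_1 mat"
  assumes M: "M \<in> carrier_mat 2 2"
  shows "det M = M $$ (0, 0) * M $$ (1, 1) - M $$ (0, 1) * M $$ (1, 0)"
proof -
  have "det (mat_delete M i 0) = mat_delete M i 0 $$ (0, 0)" for i
    using M mat_delete_carrier[OF M, of i 0] by (intro det_single) simp
  then show ?thesis
    using M by (subst laplace_expansion_column[OF M, of 0])
      (auto simp: cofactor_def mat_delete_def numeral_2_eq_2 algebra_simps)
qed

lemma mult_2x2_index:
  fixes M N :: "'a::comm_semiring_0 mat"
  assumes "M \<in> carrier_mat 2 2" and "N \<in> carrier_mat 2 2" and "i < 2" and "j < 2"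
  shows "(M * N) $$ (i, j) = M $$ (i, 0) * N $$ (0, j) + M $$ (i, 1) * N $$ (1, j)"
  using assms by (simp add: scalar_prod_def numeral_2_eq_2)

text \<open>
  The Cayley-Hamilton identity \<open>C\<^sup>2 = (tr C) C - (det C) 1\<close>, multiplied by \<open>X\<close> and read through
  the trace. It is the rewriting rule that shortens the words in \<open>word_traces\<close>.
\<close>

lemma cayley_hamilton_trace:
  fixes X C :: "'a::comm_ring_1 mat"
  assumes X: "X \<in> carrier_mat 2 2" and C: "C \<in> carrier_mat 2 2"
  shows "mat_trace (X * (C * C)) = mat_trace C * mat_trace (X * C) - det C * mat_trace X"
proof -
  have "C * C \<in> carrier_mat 2 2" "X * (C * C) \<in> carrier_mat 2 2" "X * C \<in> carrier_mat 2 2"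
    using X C by auto
  with X C show ?thesis
    by (simp add: mat_trace_2x2 det_2x2 mult_2x2_index algebra_simps del: index_mult_mat(1))
qed

lemma mat_trace_square:
  fixes C :: "'a::comm_ring_1 mat"
  assumes C: "C \<in> carrier_mat 2 2"
  shows "mat_trace (C * C) = (mat_trace C)\<^sup>2 - 2 * det C"
proof -
  have "mat_trace (1\<^sub>m 2 :: 'a mat) = 2"
    by (simp add: mat_trace_def)
  with cayley_hamilton_trace[OF one_carrier_mat C] C show ?thesis
    by (simp add: power2_eq_square algebra_simps)
qed

section \<open>The spectral radius in terms of trace and determinant\<close>

text \<open>
  For \<open>\<delta> \<ge> 0\<close> this is the larger modulus of the two roots of \<open>x\<^sup>2 - \<tau> x + \<delta>\<close>. Two nonreal roots
  are conjugate and have modulus \<open>\<surd>\<delta>\<close>, which is also the modulus of the double root that occurs for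
  \<open>\<bar>\<tau>\<bar> = 2 \<surd>\<delta>\<close>. Cutting \<open>\<bar>\<tau>\<bar>\<close> off from below at that value therefore treats real and nonreal
  roots by one formula, which makes monotonicity in \<open>\<bar>\<tau>\<bar>\<close> visible.
\<close>

definition largest_root_modulus :: "real \<Rightarrow> real \<Rightarrow> real" where
  "largest_root_modulus \<tau> \<delta> =
    (let m = max \<bar>\<tau>\<bar> (2 * sqrt \<delta>) in (m + sqrt (m\<^sup>2 - 4 * \<delta>)) / 2)"

lemma largest_root_modulus_mono:
  assumes "0 \<le> \<delta>" and "(max \<bar>\<sigma>\<bar> (2 * sqrt \<delta>)) \<le> (max \<bar>\<tau>\<bar> (2 * sqrt \<delta>))"
  shows "largest_root_modulus \<sigma> \<delta> \<le> largest_root_modulus \<tau> \<delta>"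
proof -
  have "(max \<bar>\<sigma>\<bar> (2 * sqrt \<delta>))\<^sup>2 \<le> (max \<bar>\<tau>\<bar> (2 * sqrt \<delta>))\<^sup>2"
    using assms by (intro power_mono) auto
  then show ?thesis
    using assms(2) by (simp add: largest_root_modulus_def Let_def add_mono)
qed

lemma eigenvalue_2x2_iff:
  fixes M :: "'a::field mat"
  assumes M: "M \<in> carrier_mat 2 2"
  shows "eigenvalue M e \<longleftrightarrow> e\<^sup>2 - mat_trace M * e + det M = 0"
proof -
  have "char_matrix M e \<in> carrier_mat 2 2"
    using M by simp
  then have "det (char_matrix M e) = e\<^sup>2 - mat_trace M * e + det M"
    using M by (simp add: det_2x2 mat_trace_2x2 char_matrix_def power2_eq_square algebra_simps)
  then show ?thesis
    using eigenvalue_det[OF M] by simp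
qed

lemma real_spectral_radius_2x2:
  fixes M :: "real mat"
  assumes M: "M \<in> carrier_mat 2 2" and nonneg: "0 \<le> det M"
  shows "real_spectral_radius M = largest_root_modulus (mat_trace M) (det M)"
proof -
  define \<tau> \<delta> where "\<tau> = mat_trace M" and "\<delta> = det M"
  define N where "N = map_mat complex_of_real M"
  have N: "N \<in> carrier_mat 2 2"
    using M by (simp add: N_def)
  have "mat_trace N = of_real \<tau>" "det N = of_real \<delta>"
    using M N by (simp_all add: N_def \<tau>_def \<delta>_def mat_trace_2x2 det_2x2)
  then have spec: "spectrum N = {e. e\<^sup>2 - of_real \<tau> * e + of_real \<delta> = 0}"
    by (auto simp: spectrum_def eigenvalue_2x2_iff[OF N])
  have "\<exists>e f. spectrum N = {e, f} \<and> cmod f \<le> cmod e \<and> cmod e = largest_root_modulus \<tau> \<delta>"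
  proof (cases "2 * sqrt \<delta> \<le> \<bar>\<tau>\<bar>")
    case True
    then have "(2 * sqrt \<delta>)\<^sup>2 \<le> \<bar>\<tau>\<bar>\<^sup>2"
      using nonneg by (intro power_mono) (auto simp: \<delta>_def)
    then have disc: "0 \<le> \<tau>\<^sup>2 - 4 * \<delta>"
      using nonneg by (simp add: power_mult_distrib \<delta>_def)
    \<comment> \<open>The sign of the square root is chosen so that \<open>(\<tau> + q) / 2\<close> is the dominant root.\<close>
    define q where "q = (if 0 \<le> \<tau> then sqrt (\<tau>\<^sup>2 - 4 * \<delta>) else - sqrt (\<tau>\<^sup>2 - 4 * \<delta>))"
    have q2: "q\<^sup>2 = \<tau>\<^sup>2 - 4 * \<delta>"
      using disc by (simp add: q_def)
    have "e\<^sup>2 - of_real \<tau> * e + of_real \<delta>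
        = (e - of_real ((\<tau> + q) / 2)) * (e - of_real ((\<tau> - q) / 2))" for e :: complex
    proof -
      have "(of_real q :: complex)\<^sup>2 = (of_real \<tau>)\<^sup>2 - 4 * of_real \<delta>"
        using arg_cong[OF q2, of complex_of_real] by simp
      then show ?thesis
        by (simp add: field_simps power2_eq_square)
    qed
    then have "spectrum N = {of_real ((\<tau> + q) / 2), of_real ((\<tau> - q) / 2)}"
      unfolding spec by auto
    moreover have "0 \<le> sqrt (\<tau>\<^sup>2 - 4 * \<delta>)"
      using disc by simp
    then have "\<bar>\<tau> - q\<bar> \<le> \<bar>\<tau> + q\<bar>" "\<bar>\<tau> + q\<bar> = \<bar>\<tau>\<bar> + sqrt (\<tau>\<^sup>2 - 4 * \<delta>)"
      unfolding q_def by (cases "0 \<le> \<tau>"; simp; linarith)+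
    then have "\<bar>(\<tau> - q) / 2\<bar> \<le> \<bar>(\<tau> + q) / 2\<bar>" "\<bar>(\<tau> + q) / 2\<bar> = largest_root_modulus \<tau> \<delta>"
      using True by (simp_all add: largest_root_modulus_def Let_def max_def)
    ultimately show ?thesis
      by (metis norm_of_real)
  next
    case False
    then have "\<bar>\<tau>\<bar>\<^sup>2 \<le> (2 * sqrt \<delta>)\<^sup>2"
      by (intro power_mono) auto
    then have disc: "0 \<le> 4 * \<delta> - \<tau>\<^sup>2"
      using nonneg by (simp add: power_mult_distrib \<delta>_def)
    define q where "q = sqrt (4 * \<delta> - \<tau>\<^sup>2)"
    have q2: "q\<^sup>2 = 4 * \<delta> - \<tau>\<^sup>2"
      using disc by (simp add: q_def)
    have "e\<^sup>2 - of_real \<tau> * e + of_real \<delta>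
        = (e - Complex (\<tau> / 2) (q / 2)) * (e - Complex (\<tau> / 2) (- q / 2))" for e :: complex
      using q2 by (simp add: complex_eq_iff field_simps power2_eq_square)
    then have "spectrum N = {Complex (\<tau> / 2) (q / 2), Complex (\<tau> / 2) (- q / 2)}"
      unfolding spec by auto
    moreover have "(\<tau> / 2)\<^sup>2 + (q / 2)\<^sup>2 = \<delta>"
      using q2 by (simp add: power_divide field_simps)
    then have "cmod (Complex (\<tau> / 2) (q / 2)) = sqrt \<delta>"
      and "cmod (Complex (\<tau> / 2) (- q / 2)) = sqrt \<delta>"
      by (simp_all add: cmod_def)
    moreover have "largest_root_modulus \<tau> \<delta> = sqrt \<delta>"
      using False nonneg
      by (simp add: largest_root_modulus_def Let_def max_def power_mult_distrib \<delta>_def)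
    ultimately show ?thesis
      by (metis order_refl)
  qed
  then show ?thesis
    unfolding real_spectral_radius_def N_def[symmetric] spectral_radius_def \<tau>_def \<delta>_def
    by (auto simp: max_def)
qed

section \<open>The words that compete\<close>

lemma word_prod_carrier:
  assumes "A \<in> carrier_mat 2 2" and "B \<in> carrier_mat 2 2"
  shows "word_prod A B u \<in> carrier_mat 2 2"
  using assms by (induction u) (auto simp: word_prod_def letter_mat_def)

lemma det_word_prod:
  assumes "A \<in> carrier_mat 2 2" and "B \<in> carrier_mat 2 2"
  shows "det (word_prod A B u) = (\<Prod>d\<leftarrow>u. det (letter_mat A B d))"
proof (induction u)
  case (Cons a u)
  have "letter_mat A B a \<in> carrier_mat 2 2"
    using assms by (simp add: letter_mat_def)
  then have "det (letter_mat A B a * word_prod A B u)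
      = det (letter_mat A B a) * det (word_prod A B u)"
    using word_prod_carrier[OF assms] by (rule det_mult)
  with Cons show ?case
    by (simp add: word_prod_def)
qed (simp add: word_prod_def)

text \<open>
  The square of \<open>AABB\<close> and the fourth power of \<open>AB\<close> only need \<open>mat_trace_square\<close>. For the other two
  words put \<open>C = A B\<close> and \<open>D = B A\<close>. Both have a cyclic shift that ends in \<open>C C\<close>, and
  \<open>cayley_hamilton_trace\<close> reduces them, up to cyclic shifts, to \<open>C\<close>, \<open>C C\<close> and \<open>D C\<close>. The last one
  has trace \<open>t\<close>, because \<open>BAAB\<close> is a cyclic shift of \<open>AABB\<close>.
\<close>

lemma word_traces:
  fixes A B :: "real mat"
  assumes A: "A \<in> carrier_mat 2 2" and B: "B \<in> carrier_mat 2 2"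
  defines "d \<equiv> det A * det B" and "s \<equiv> (mat_trace (A * B))\<^sup>2"
    and "t \<equiv> mat_trace (A * A * B * B)"
  shows "mat_trace (word_prod A B [1,1,2,1,2,1,2,2]) = (s - d) * t - s * d"
    and "mat_trace (word_prod A B [1,2,1,2,1,2,1,2]) = (s - 2 * d)\<^sup>2 - 2 * d\<^sup>2"
    and "mat_trace (word_prod A B [1,1,2,2,1,1,2,2]) = t\<^sup>2 - 2 * d\<^sup>2"
    and "mat_trace (word_prod A B [1,1,2,1,2,2,1,2]) = s * (t - d) - d * (s - 2 * d)"
proof -
  define C D F where "C = A * B" and "D = B * A" and "F = A * A * B * B"
  define z where "z = mat_trace C"
  note assoc = assoc_mult_mat[of _ 2 2 _ 2 _ 2]
  note comm = mat_trace_mult_commute[of _ 2 2]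
  have carrier: "C \<in> carrier_mat 2 2" "D \<in> carrier_mat 2 2" "F \<in> carrier_mat 2 2"
    using A B by (auto simp: C_def D_def F_def)
  have det: "det C = d" "det D = d" "det F = d\<^sup>2"
    using A B by (simp_all add: C_def D_def F_def d_def det_mult[of _ 2] power2_eq_square)
  have trD: "mat_trace D = z"
    using comm[OF A B] by (simp add: z_def C_def D_def)
  have trDC: "mat_trace (D * C) = t"
    using comm[of "A * A * B" B] A B by (simp add: t_def C_def D_def assoc)
  have CC: "mat_trace (C * C) = s - 2 * d"
    using mat_trace_square[OF carrier(1)] det by (simp add: s_def C_def)
  have s: "s = z * z"
    by (simp add: s_def z_def C_def power2_eq_square)

  have "mat_trace (word_prod A B [1,1,2,1,2,1,2,2]) = mat_trace (D * C * (C * C))"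
    using comm[of "A * A * B * A * B * A * B" B] A B
    by (simp add: word_prod_def letter_mat_def C_def D_def assoc)
  also have "\<dots> = z * mat_trace (D * (C * C)) - d * t"
    using cayley_hamilton_trace[of "D * C" C] carrier
    by (simp add: det trDC assoc flip: z_def)
  also have "mat_trace (D * (C * C)) = z * t - d * z"
    using cayley_hamilton_trace[of D C] carrier
    by (simp add: det trDC trD flip: z_def)
  finally show "mat_trace (word_prod A B [1,1,2,1,2,1,2,2]) = (s - d) * t - s * d"
    by (simp add: s algebra_simps)

  have "word_prod A B [1,2,1,2,1,2,1,2] = (C * C) * (C * C)"
    using A B by (simp add: word_prod_def letter_mat_def C_def assoc)
  then show "mat_trace (word_prod A B [1,2,1,2,1,2,1,2]) = (s - 2 * d)\<^sup>2 - 2 * d\<^sup>2"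
    using mat_trace_square[of "C * C"] carrier det CC
    by (simp add: det_mult[of _ 2] power2_eq_square)

  have "word_prod A B [1,1,2,2,1,1,2,2] = F * F"
    using A B by (simp add: word_prod_def letter_mat_def F_def assoc)
  then show "mat_trace (word_prod A B [1,1,2,2,1,1,2,2]) = t\<^sup>2 - 2 * d\<^sup>2"
    using mat_trace_square[OF carrier(3)] det by (simp add: t_def F_def power_mult_distrib)

  have "mat_trace (word_prod A B [1,1,2,1,2,2,1,2]) = mat_trace (B * C * A * (C * C))"
    using comm[of "A * A * B * A * B" "B * A * B"] A B
    by (simp add: word_prod_def letter_mat_def C_def assoc)
  also have "\<dots> = z * mat_trace (B * C * A * C) - d * mat_trace (B * C * A)"
    using cayley_hamilton_trace[of "B * C * A" C] carrier A B
    by (simp add: det assoc flip: z_def)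
  also have "mat_trace (B * C * A) = mat_trace (C * C)"
    using comm[of B "A * B * A"] A B by (simp add: C_def assoc)
  also have "mat_trace (B * C * A * C) = mat_trace (C * (D * D))"
    using comm[of "B * A * B * A" "A * B"] A B by (simp add: C_def D_def assoc)
  also have "\<dots> = z * t - d * z"
    using cayley_hamilton_trace[of C D] comm[of C D] carrier
    by (simp add: det trD trDC flip: z_def)
  finally show "mat_trace (word_prod A B [1,1,2,1,2,2,1,2]) = s * (t - d) - d * (s - 2 * d)"
    by (simp add: s CC algebra_simps)
qed

lemma cyclic_shift_of_iff_bounded:
  assumes "v \<noteq> []"
  shows "cyclic_shift_of u v \<longleftrightarrow> (\<exists>k<length v. u = rotate k v)"
  unfolding cyclic_shift_of_def using assms
  by (metis length_greater_0_conv mod_less_divisor rotate_conv_mod)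

lemma competing_words_not_shifts:
  assumes "u \<in> {[1,2,1,2,1,2,1,2], [1,1,2,2,1,1,2,2], [1,1,2,1,2,2,1,2]}"
  shows "\<not> cyclic_shift_of u w_word" and "\<not> cyclic_shift_of u (rev w_word)"
  using assms
  by (elim insertE emptyE;
      simp add: w_word_def cyclic_shift_of_iff_bounded Ex_less_Suc All_less_Suc rotate_drop_take)+

section \<open>The inequality between the traces\<close>

text \<open>
  In terms of \<open>e = - d\<close> and \<open>S = s - 2 d\<close>, which is the trace of \<open>(AB)\<^sup>2\<close>, the polynomial becomes
  \<open>(S - e) t + (S - 2 e) e\<close> with nonnegative coefficients \<open>S - e\<close> and \<open>S - 2 e\<close>. Replacing
  \<open>S\<close> and \<open>\<bar>t\<bar>\<close> both by the larger one, \<open>m\<close> say, can only increase the bound on its absolute value,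
  which then equals \<open>m\<^sup>2 - 2 e\<^sup>2\<close>.
\<close>

lemma trace_inequality_nonpos:
  fixes s t d :: real
  assumes s: "0 \<le> s" and d: "d \<le> 0"
  defines "W \<equiv> (s - d) * t - s * d"
  shows "\<bar>W\<bar> \<le> (s - 2 * d)\<^sup>2 - 2 * d\<^sup>2 \<or> \<bar>W\<bar> \<le> t\<^sup>2 - 2 * d\<^sup>2"
proof -
  define e S where "e = - d" and "S = s - 2 * d"
  have e: "0 \<le> e" "2 * e \<le> S"
    using s d by (auto simp: e_def S_def)
  have W: "W = (S - e) * t + (S - 2 * e) * e"
    by (simp add: W_def e_def S_def algebra_simps)
  define T where "T = \<bar>t\<bar>"
  have eS: "2 * e * e \<le> e * S"
    using e mult_left_mono[of "2 * e" S e] by simp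
  show ?thesis
  proof (cases "T \<le> S")
    case True
    have "\<bar>(S - e) * t\<bar> \<le> (S - e) * S"
      using True e by (simp add: abs_mult T_def mult_left_mono)
    moreover have "0 \<le> (S - 2 * e) * e"
      using e by simp
    ultimately have "\<bar>W\<bar> \<le> (S - e) * S + (S - 2 * e) * e"
      unfolding W by linarith
    then have "\<bar>W\<bar> \<le> S\<^sup>2 - 2 * e\<^sup>2"
      by (simp add: power2_eq_square algebra_simps)
    then show ?thesis
      by (simp add: S_def e_def)
  next
    case False
    have "\<bar>(S - e) * t\<bar> = (S - e) * T"
      using e by (simp add: abs_mult T_def)
    moreover have "0 \<le> (S - 2 * e) * e"
      using e by simp
    ultimately have "\<bar>W\<bar> \<le> (S - e) * T + (S - 2 * e) * e"
      unfolding W by linarith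
    also have "\<dots> \<le> (T - e) * T + (T - 2 * e) * e"
      using False e by (intro add_mono mult_right_mono) (auto simp: T_def)
    finally have "\<bar>W\<bar> \<le> T\<^sup>2 - 2 * e\<^sup>2"
      by (simp add: power2_eq_square algebra_simps)
    then show ?thesis
      by (simp add: T_def e_def)
  qed
qed

text \<open>
  Here \<open>W = (s - d) (t - d) - d\<^sup>2\<close>, so the signs of \<open>s - d\<close> and \<open>t - d\<close> decide. For \<open>s \<le> d\<close> the
  polynomial is at most linear in \<open>\<bar>t\<bar>\<close> and is beaten by \<open>t\<^sup>2 - 2 d\<^sup>2\<close> or by \<open>2 d\<^sup>2\<close>. For \<open>s > d\<close>
  the two sides of the line \<open>t = s - 2 d\<close> behave differently. If \<open>t \<le> s - 2 d\<close>, positive values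
  are bounded by monotonicity in \<open>t\<close>, which gives the value \<open>(s - 2 d)\<^sup>2 - 2 d\<^sup>2\<close> on the line, while
  negative values are bounded by the trace of \<open>AABABBAB\<close>: it differs from \<open>W\<close> by exactly
  \<open>d (t + 2 d - s)\<close>. If \<open>t > s - 2 d\<close>, monotonicity in \<open>s\<close> gives the value on the line,
  \<open>t\<^sup>2 - 2 d\<^sup>2\<close>, as a bound for \<open>W\<close> when \<open>t > d\<close>, and its negative, which is at most \<open>2 d\<^sup>2\<close>, as a bound
  for \<open>- W\<close> otherwise.
\<close>

lemma trace_inequality_pos:
  fixes s t d :: real
  assumes s: "0 \<le> s" and d: "0 < d"
  defines "W \<equiv> (s - d) * t - s * d"
  shows "\<bar>W\<bar> \<le> 2 * d\<^sup>2 \<or> \<bar>W\<bar> \<le> (s - 2 * d)\<^sup>2 - 2 * d\<^sup>2 \<or> \<bar>W\<bar> \<le> t\<^sup>2 - 2 * d\<^sup>2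
    \<or> \<bar>W\<bar> \<le> \<bar>s * (t - d) - d * (s - 2 * d)\<bar>"
proof -
  have W: "W = (s - d) * (t - d) - d * d"
    by (simp add: W_def algebra_simps)
  have linear_beaten: "d * r \<le> 2 * d\<^sup>2 \<or> d * r \<le> r\<^sup>2 - 2 * d\<^sup>2" for r
  proof (cases "r \<le> 2 * d")
    case True
    then show ?thesis
      using mult_left_mono[of r "2 * d" d] d by (simp add: power2_eq_square)
  next
    case False
    then have "0 \<le> (r - 2 * d) * (r + d)"
      using d by (intro mult_nonneg_nonneg) auto
    then show ?thesis
      by (simp add: power2_eq_square algebra_simps)
  qed
  consider "s \<le> d" | "d < s" "t + 2 * d \<le> s" | "d < s" "s < t + 2 * d" "t \<le> d"
    | "d < s" "s < t + 2 * d" "d < t"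
    by linarith
  then show ?thesis
  proof cases
    case 1
    \<comment> \<open>\<open>W + d\<^sup>2\<close> lies between \<open>0\<close> and \<open>d (d - t)\<close>, hence \<open>W\<close> between \<open>- d\<^sup>2\<close> and \<open>- d t\<close>.\<close>
    have WW: "W = (d - s) * (d - t) - d * d"
      by (simp add: W algebra_simps)
    have "\<bar>W\<bar> \<le> d * d \<or> \<bar>W\<bar> \<le> d * \<bar>t\<bar>"
    proof (cases "t \<le> d")
      case True
      have "(d - s) * (d - t) \<le> d * (d - t)" "0 \<le> (d - s) * (d - t)"
        using 1 s True by (auto intro: mult_right_mono)
      then have "- (d * d) \<le> W" "W \<le> - (d * t)"
        unfolding WW by (auto simp: right_diff_distrib)
      moreover have "- (d * t) \<le> d * \<bar>t\<bar>"
        using d mult_left_mono[of "- t" "\<bar>t\<bar>" d] by auto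
      ultimately show ?thesis
        by linarith
    next
      case False
      have "d * (d - t) \<le> (d - s) * (d - t)" "(d - s) * (d - t) \<le> 0"
        using 1 s False by (auto intro: mult_right_mono_neg simp: mult_nonneg_nonpos)
      then have "- (d * t) \<le> W" "W \<le> 0"
        unfolding WW right_diff_distrib[of d] using zero_le_square[of d] by linarith+
      then show ?thesis
        using False d by simp
    qed
    moreover have "d * d \<le> 2 * d\<^sup>2"
      by (simp add: power2_eq_square)
    ultimately show ?thesis
      using linear_beaten[of "\<bar>t\<bar>"] by auto
  next
    case 2
    have "- W \<le> - (s * (t - d) - d * (s - 2 * d))"
      using mult_left_mono[of "t + 2 * d" s d] 2 d by (simp add: W_def algebra_simps)
    moreover have "(s - d) * (t - d) \<le> (s - d) * (s - 3 * d)"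
      using 2 by (intro mult_left_mono) auto
    then have "W \<le> (s - d) * (s - 3 * d) - d * d"
      unfolding W by simp
    then have "W \<le> (s - 2 * d)\<^sup>2 - 2 * d\<^sup>2"
      by (simp add: power2_eq_square algebra_simps)
    ultimately show ?thesis
      by linarith
  next
    case 3
    have "(s - d) * (d - t) \<le> (t + d) * (d - t)" "0 \<le> (s - d) * (d - t)"
      using 3 by (auto intro!: mult_right_mono)
    moreover have "(t + d) * (d - t) + d * d = 2 * d\<^sup>2 - t\<^sup>2"
      by (simp add: power2_eq_square algebra_simps)
    moreover have "- W = (s - d) * (d - t) + d * d"
      by (simp add: W algebra_simps)
    moreover have "0 \<le> t\<^sup>2" "0 \<le> d * d"
      by simp_all
    ultimately show ?thesis
      by linarith
  next
    case 4
    have "(s - d) * (t - d) \<le> (t + d) * (t - d)" "0 \<le> (s - d) * (t - d)"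
      using 4 by (auto intro!: mult_right_mono)
    moreover have "(t + d) * (t - d) - d * d = t\<^sup>2 - 2 * d\<^sup>2"
      by (simp add: power2_eq_square algebra_simps)
    moreover have "d * d \<le> 2 * d\<^sup>2"
      by (simp add: power2_eq_square)
    ultimately show ?thesis
      unfolding W by linarith
  qed
qed

lemma trace_inequality:
  fixes s t d :: real
  assumes s: "0 \<le> s"
  defines "W \<equiv> (s - d) * t - s * d"
  shows "\<bar>W\<bar> \<le> 2 * d\<^sup>2 \<or> \<bar>W\<bar> \<le> \<bar>(s - 2 * d)\<^sup>2 - 2 * d\<^sup>2\<bar> \<or> \<bar>W\<bar> \<le> \<bar>t\<^sup>2 - 2 * d\<^sup>2\<bar>
    \<or> \<bar>W\<bar> \<le> \<bar>s * (t - d) - d * (s - 2 * d)\<bar>"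
  using trace_inequality_nonpos[OF s, of d t] trace_inequality_pos[OF s, of d t]
  unfolding W_def by linarith

theorem theorem5p1:
  fixes A B :: "real mat"
  assumes "A \<in> carrier_mat 2 2" and "B \<in> carrier_mat 2 2"
  shows "\<exists>u. set u \<subseteq> {1, 2} \<and> 1 \<le> length u \<and> length u \<le> 8
    \<and> \<not> cyclic_shift_of u w_word \<and> \<not> cyclic_shift_of u (rev w_word)
    \<and> normalized_spectral_radius A B u \<ge> normalized_spectral_radius A B w_word"
proof -
  define d where "d = det A * det B"
  define \<tau> where "\<tau> = (\<lambda>u. mat_trace (word_prod A B u))"
  define cands :: "nat list set" where
    "cands = {[1,2,1,2,1,2,1,2], [1,1,2,2,1,1,2,2], [1,1,2,1,2,2,1,2]}"
  have radius: "normalized_spectral_radius A B u = root 8 (largest_root_modulus (\<tau> u) (d ^ 4))"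
    if "u \<in> insert w_word cands" for u
  proof -
    have det: "det (word_prod A B u) = d ^ 4" and len: "length u = 8"
      using that
      by (auto simp: cands_def w_word_def det_word_prod[OF assms] letter_mat_def d_def
          power_mult_distrib power4_eq_xxxx)
    then show ?thesis
      using real_spectral_radius_2x2[OF word_prod_carrier[OF assms], of u]
      by (simp add: normalized_spectral_radius_def \<tau>_def)
  qed
  have sqrt: "sqrt (d ^ 4) = d\<^sup>2"
    using real_sqrt_abs[of "d\<^sup>2"] by simp
  have "\<bar>\<tau> w_word\<bar> \<le> 2 * d\<^sup>2 \<or> (\<exists>u\<in>cands. \<bar>\<tau> w_word\<bar> \<le> \<bar>\<tau> u\<bar>)"
    using trace_inequality[of "(mat_trace (A * B))\<^sup>2" d "mat_trace (A * A * B * B)"]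
    unfolding cands_def \<tau>_def w_word_def d_def word_traces[OF assms, symmetric]
    by auto
  \<comment> \<open>In the first case the radius is the least one that the determinant permits, so that any
    competitor will do.\<close>
  moreover have "cands \<noteq> {}"
    by (simp add: cands_def)
  ultimately obtain u where u: "u \<in> cands" "\<bar>\<tau> w_word\<bar> \<le> 2 * d\<^sup>2 \<or> \<bar>\<tau> w_word\<bar> \<le> \<bar>\<tau> u\<bar>"
    by blast
  have "largest_root_modulus (\<tau> w_word) (d ^ 4) \<le> largest_root_modulus (\<tau> u) (d ^ 4)"
    using u(2) by (intro largest_root_modulus_mono) (auto simp: sqrt)
  then have "normalized_spectral_radius A B w_word \<le> normalized_spectral_radius A B u"
    using u(1) by (simp add: radius)
  moreover have "set u \<subseteq> {1, 2}" "length u = 8"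
    using u(1) by (auto simp: cands_def)
  ultimately show ?thesis
    using competing_words_not_shifts u(1) unfolding cands_def
    by (intro exI[of _ u]) auto
qed

end
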